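(* Let $\mathcal{A}$ be an algebraically consistent functional Banach space of analytic functions on $\mathbb{D}$ such that polynomials are dense in $\mathcal{A}$ and $p\mathcal{A}\subset\mathcal{A}$ for all polynomials $p$. Let $\psi$ be an analytic function on $\mathbb{D}$ with $\psi\mathcal{A}\subset\mathcal{A}$, and let $T$ be a nonzero bounded linear operator on the normed space $\psi\mathcal{A}$. Then $T$ is almost multiplicative if and only if $T$ is a composition operator on $\psi\mathcal{A}$.
   Context: $\mathbb{D}$ is the open unit disc in $\mathbb{C}$. For a function $h$ on $\mathbb{D}$, $h\mathcal{A}=\{hf:f\in\mathcal{A}\}$; $\psi\mathcal{A}$ carries the norm of $\mathcal{A}$. "Polynomials are dense in $\mathcal{A}$" includes that polynomials belong to $\mathcal{A}$. A functional Banach space on $\mathbb{D}$ is a Banach space of complex functions on $\mathbb{D}$ with pointwise vector operations, in which two functions equal at every point are the same element, the functions separate points of $\mathbb{D}$ (if $f(x)=f(y)$ for all $f$ then $x=y$), and every evaluation $f\mapsto f(x)$, $x\in\mathbb{D}$, is bounded. A bounded linear operator $T$ (resp. bounded linear functional $k$) on a normed space $X$ of analytic functions on $\mathbb{D}$ is almost multiplicative if $T(fg)=T(f)T(g)$ (resp. $k(fg)=k(f)k(g)$) whenever $f,g,fg\in X$. A space $X$ of analytic functions on $\mathbb{D}$ on which all evaluation maps are bounded is algebraically consistent if every nonzero almost multiplicative bounded linear functional on $X$ is evaluation at some point of $\mathbb{D}$. $T$ is a composition operator on $X$ if there is an analytic map $\varphi:\mathbb{D}\to\mathbb{D}$ with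 $Tf=f\circ\varphi$ for all $f\in X$. *)

theory Defs
  imports "HOL-Analysis.Analysis" "HOL-Library.Function_Algebras" "HOL-Library.Set_Algebras"
begin

text \<open>
  The open unit disc is a type of its own, so that two functions on the disc are equal exactly
  when they agree at every point of the disc. The pointwise operations on functions are those of
  \<^theory>\<open>HOL-Library.Function_Algebras\<close>, and the set of all products of \<open>h\<close> with an element
  of \<open>A\<close> is \<open>h *o A\<close> from \<^theory>\<open>HOL-Library.Set_Algebras\<close>.
\<close>

typedef disc = "ball 0 1 :: complex set"
  morphisms of_disc Disc
  by (rule exI[of _ 0]) simp

definition analytic_fun :: "(disc \<Rightarrow> complex) \<Rightarrow> bool" where
  "analytic_fun f \<longleftrightarrow> (\<exists>F. F analytic_on ball 0 1 \<and> (\<forall>z. f z = F (of_disc z)))"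

definition analytic_self_map :: "(disc \<Rightarrow> disc) \<Rightarrow> bool" where
  "analytic_self_map \<phi> \<longleftrightarrow> analytic_fun (\<lambda>z. of_disc (\<phi> z))"

definition poly_fun :: "complex poly \<Rightarrow> disc \<Rightarrow> complex" where
  "poly_fun p = (\<lambda>z. poly p (of_disc z))"

text \<open>
  A normed space of functions is given by its carrier \<open>X\<close> and a norm \<open>N\<close>, of which only the
  values on \<open>X\<close> matter. Likewise only the values on \<open>X\<close> of a map defined on the space matter.
\<close>

definition normed_function_space :: "('a \<Rightarrow> complex) set \<Rightarrow> (('a \<Rightarrow> complex) \<Rightarrow> real) \<Rightarrow> bool" where
  "normed_function_space X N \<longleftrightarrow>
     0 \<in> X \<and>
     (\<forall>f\<in>X. \<forall>g\<in>X. f + g \<in> X) \<and>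
     (\<forall>c. \<forall>f\<in>X. (\<lambda>z. c * f z) \<in> X) \<and>
     (\<forall>f\<in>X. 0 \<le> N f \<and> (N f = 0 \<longleftrightarrow> f = 0)) \<and>
     (\<forall>c. \<forall>f\<in>X. N (\<lambda>z. c * f z) = cmod c * N f) \<and>
     (\<forall>f\<in>X. \<forall>g\<in>X. N (f + g) \<le> N f + N g)"

text \<open>
  The locale \<^locale>\<open>Metric_space\<close> asks for a nonnegative symmetric distance on the whole type,
  while \<open>N\<close> is arbitrary outside \<open>X\<close>; hence the irrelevant value 0 there.
\<close>

definition norm_dist ::
    "('a \<Rightarrow> complex) set \<Rightarrow> (('a \<Rightarrow> complex) \<Rightarrow> real) \<Rightarrow> ('a \<Rightarrow> complex) \<Rightarrow> ('a \<Rightarrow> complex) \<Rightarrow> real" where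
  "norm_dist X N f g = (if f \<in> X \<and> g \<in> X then N (f - g) else 0)"

lemma Metric_space_norm_dist:
  assumes "normed_function_space X N"
  shows "Metric_space X (norm_dist X N)"
proof -
  have add: "f + g \<in> X" and tri: "N (f + g) \<le> N f + N g" if "f \<in> X" "g \<in> X" for f g
    using assms that unfolding normed_function_space_def by auto
  have nonneg: "0 \<le> N f" and zero: "N f = 0 \<longleftrightarrow> f = 0" if "f \<in> X" for f
    using assms that unfolding normed_function_space_def by auto
  have neg_eq: "(\<lambda>z. (-1) * f z) = - f" for f :: "'a \<Rightarrow> complex"
    by (simp add: fun_eq_iff)
  have minus: "- f \<in> X" "N (- f) = N f" if "f \<in> X" for f
  proof -
    have smult: "\<forall>c. \<forall>f\<in>X. (\<lambda>z. c * f z) \<in> X"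
      using assms unfolding normed_function_space_def by (elim conjE)
    have norm_smult: "\<forall>c. \<forall>f\<in>X. N (\<lambda>z. c * f z) = cmod c * N f"
      using assms unfolding normed_function_space_def by (elim conjE)
    from smult[rule_format, OF that, of "-1"] norm_smult[rule_format, OF that, of "-1"]
    show "- f \<in> X" "N (- f) = N f"
      unfolding neg_eq by simp_all
  qed
  have diff: "f - g \<in> X" if "f \<in> X" "g \<in> X" for f g
    using add[OF that(1) minus(1)[OF that(2)]] by (simp only: add_uminus_conv_diff)
  have comm: "N (f - g) = N (g - f)" if "f \<in> X" "g \<in> X" for f g
    using minus(2)[OF diff[OF that]] by (simp only: minus_diff_eq)
  show ?thesis
  proof
    fix f g show "0 \<le> norm_dist X N f g"
      by (simp add: norm_dist_def nonneg diff)
    show "norm_dist X N f g = norm_dist X N g f"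
      using comm by (simp add: norm_dist_def)
  next
    fix f g assume "f \<in> X" "g \<in> X"
    then show "norm_dist X N f g = 0 \<longleftrightarrow> f = g"
      by (simp only: norm_dist_def if_True simp_thms zero diff right_minus_eq)
  next
    fix f g h assume "f \<in> X" "g \<in> X" "h \<in> X"
    then show "norm_dist X N f h \<le> norm_dist X N f g + norm_dist X N g h"
      using tri[OF diff diff, of f g g h] by (simp only: norm_dist_def if_True simp_thms diff_add_cancel add_diff_eq)
  qed
qed

definition bounded_functional ::
    "('a \<Rightarrow> complex) set \<Rightarrow> (('a \<Rightarrow> complex) \<Rightarrow> real) \<Rightarrow> (('a \<Rightarrow> complex) \<Rightarrow> complex) \<Rightarrow> bool" where
  "bounded_functional X N k \<longleftrightarrow>
     (\<forall>f\<in>X. \<forall>g\<in>X. k (f + g) = k f + k g) \<and>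
     (\<forall>c. \<forall>f\<in>X. k (\<lambda>z. c * f z) = c * k f) \<and>
     (\<exists>C. \<forall>f\<in>X. cmod (k f) \<le> C * N f)"

definition bounded_operator ::
    "('a \<Rightarrow> complex) set \<Rightarrow> (('a \<Rightarrow> complex) \<Rightarrow> real) \<Rightarrow>
     (('a \<Rightarrow> complex) \<Rightarrow> ('a \<Rightarrow> complex)) \<Rightarrow> bool" where
  "bounded_operator X N T \<longleftrightarrow>
     (\<forall>f\<in>X. T f \<in> X) \<and>
     (\<forall>f\<in>X. \<forall>g\<in>X. T (f + g) = T f + T g) \<and>
     (\<forall>c. \<forall>f\<in>X. T (\<lambda>z. c * f z) = (\<lambda>z. c * T f z)) \<and>
     (\<exists>C. \<forall>f\<in>X. N (T f) \<le> C * N f)"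

definition functional_banach_space :: "('a \<Rightarrow> complex) set \<Rightarrow> (('a \<Rightarrow> complex) \<Rightarrow> real) \<Rightarrow> bool" where
  "functional_banach_space X N \<longleftrightarrow>
     normed_function_space X N \<and>
     Metric_space.mcomplete X (norm_dist X N) \<and>
     (\<forall>x y. (\<forall>f\<in>X. f x = f y) \<longrightarrow> x = y) \<and>
     (\<forall>x. bounded_functional X N (\<lambda>f. f x))"

text \<open>The codomain is left open so as to cover both functionals and operators.\<close>

definition almost_multiplicative ::
    "('a \<Rightarrow> complex) set \<Rightarrow> (('a \<Rightarrow> complex) \<Rightarrow> 'b::times) \<Rightarrow> bool" where
  "almost_multiplicative X T \<longleftrightarrow>
     (\<forall>f\<in>X. \<forall>g\<in>X. f * g \<in> X \<longrightarrow> T (f * g) = T f * T g)"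

definition algebraically_consistent ::
    "('a \<Rightarrow> complex) set \<Rightarrow> (('a \<Rightarrow> complex) \<Rightarrow> real) \<Rightarrow> bool" where
  "algebraically_consistent X N \<longleftrightarrow>
     (\<forall>x. bounded_functional X N (\<lambda>f. f x)) \<and>
     (\<forall>k. bounded_functional X N k \<and> almost_multiplicative X k \<and> (\<exists>f\<in>X. k f \<noteq> 0) \<longrightarrow>
        (\<exists>x. \<forall>f\<in>X. k f = f x))"

definition polynomials_dense ::
    "(disc \<Rightarrow> complex) set \<Rightarrow> ((disc \<Rightarrow> complex) \<Rightarrow> real) \<Rightarrow> bool" where
  "polynomials_dense X N \<longleftrightarrow>
     range poly_fun \<subseteq> X \<and>
     Metric_space.mtopology X (norm_dist X N) closure_of range poly_fun = X"

definition composition_operator ::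
    "(disc \<Rightarrow> complex) set \<Rightarrow> ((disc \<Rightarrow> complex) \<Rightarrow> (disc \<Rightarrow> complex)) \<Rightarrow> bool" where
  "composition_operator X T \<longleftrightarrow> (\<exists>\<phi>. analytic_self_map \<phi> \<and> (\<forall>f\<in>X. T f = f \<circ> \<phi>))"

end

theory Submission
  imports Defs "HOL-Complex_Analysis.Complex_Analysis"
begin

text \<open>
  For each \<open>w\<close> the functional \<open>f \<mapsto> (T f) w\<close> is almost multiplicative on \<open>\<psi>A\<close>. Multiplication by
  \<open>\<psi>\<close> is bounded on \<open>A\<close> by the closed graph theorem, and so \<open>\<psi>A\<close> inherits algebraic consistency
  from \<open>A\<close>: the functional is zero or evaluation at a point \<open>\<phi> w\<close>, according to whether \<open>(T \<psi>) w\<close>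
  vanishes. Where it does not, \<open>\<phi> w = (T (\<psi>z)) w / (T \<psi>) w\<close>. This bounded quotient extends
  analytically across the isolated zeros of \<open>T \<psi>\<close>, the extension maps into the open disc by the
  maximum principle, and \<open>T \<psi> = \<psi> \<circ> \<phi>\<close> persists at the zeros by continuity.
\<close>

section \<open>Norm arithmetic, closure and completeness in a normed space of functions\<close>

context
  fixes X :: "('a \<Rightarrow> complex) set" and N :: "('a \<Rightarrow> complex) \<Rightarrow> real"
  assumes X: "normed_function_space X N"
begin

lemmas nfs_conjuncts = X[unfolded normed_function_space_def]

lemma nfs_add: "f \<in> X \<Longrightarrow> g \<in> X \<Longrightarrow> f + g \<in> X"
  using nfs_conjuncts[THEN conjunct2, THEN conjunct1] by blast

lemma nfs_scale: "f \<in> X \<Longrightarrow> (\<lambda>z. c * f z) \<in> X"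
  using nfs_conjuncts[THEN conjunct2, THEN conjunct2, THEN conjunct1] by blast

lemma nfs_norm_nonneg: "f \<in> X \<Longrightarrow> 0 \<le> N f"
  and nfs_norm_eq_0: "f \<in> X \<Longrightarrow> N f = 0 \<longleftrightarrow> f = 0"
  using nfs_conjuncts[THEN conjunct2, THEN conjunct2, THEN conjunct2, THEN conjunct1] by blast+

lemma nfs_norm_scale: "f \<in> X \<Longrightarrow> N (\<lambda>z. c * f z) = cmod c * N f"
  using nfs_conjuncts[THEN conjunct2, THEN conjunct2, THEN conjunct2, THEN conjunct2, THEN conjunct1]
  by blast

lemma nfs_norm_triangle: "f \<in> X \<Longrightarrow> g \<in> X \<Longrightarrow> N (f + g) \<le> N f + N g"
  using nfs_conjuncts[THEN conjunct2, THEN conjunct2, THEN conjunct2, THEN conjunct2, THEN conjunct2]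
  by blast

lemma nfs_zero: "0 \<in> X" "N 0 = 0"
  using nfs_conjuncts[THEN conjunct1] nfs_norm_eq_0[of 0] by simp_all

lemma nfs_minus: "f \<in> X \<Longrightarrow> - f \<in> X" "f \<in> X \<Longrightarrow> N (- f) = N f"
proof -
  have neg: "(\<lambda>z. -1 * f z) = - f"
    by (simp add: fun_eq_iff)
  show "f \<in> X \<Longrightarrow> - f \<in> X" "f \<in> X \<Longrightarrow> N (- f) = N f"
    using nfs_scale[of f "-1"] nfs_norm_scale[of f "-1"] unfolding neg by simp_all
qed

lemma nfs_diff: "f \<in> X \<Longrightarrow> g \<in> X \<Longrightarrow> f - g \<in> X"
  using nfs_add[of f "- g"] nfs_minus[of g] by simp

lemma nfs_norm_diff_le: "f \<in> X \<Longrightarrow> g \<in> X \<Longrightarrow> N (f - g) \<le> N f + N g"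
  using nfs_norm_triangle[of f "- g"] nfs_minus[of g] by simp

lemma nfs_norm_commute: "f \<in> X \<Longrightarrow> g \<in> X \<Longrightarrow> N (f - g) = N (g - f)"
  using nfs_minus(2)[OF nfs_diff, of f g] by simp

lemma bounded_functional_diff:
  assumes "bounded_functional X N k" "f \<in> X" "g \<in> X"
  shows "k (f - g) = k f - k g"
proof -
  have "k ((f - g) + g) = k (f - g) + k g"
    using assms nfs_diff unfolding bounded_functional_def by blast
  then show ?thesis by simp
qed

text \<open>Linearity turns the difference of values into \<open>k (f n - g)\<close>, which
  \<open>C * N (f n - g)\<close> controls. For point evaluations this passes from norm limits to
  pointwise limits; in the density argument it passes from polynomials to all of the space.\<close>

lemma bounded_functional_tendsto:
  assumes k: "bounded_functional X N k" and f: "\<And>n. f n \<in> X" and g: "g \<in> X"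
    and lim: "(\<lambda>n. N (f n - g)) \<longlonglongrightarrow> 0"
  shows "(\<lambda>n. k (f n)) \<longlonglongrightarrow> k g"
proof -
  obtain C where C: "\<And>f. f \<in> X \<Longrightarrow> cmod (k f) \<le> C * N f"
    using k unfolding bounded_functional_def by blast
  have "cmod (k (f n) - k g) \<le> C * N (f n - g)" for n
    using C[OF nfs_diff[OF f g]] by (simp add: bounded_functional_diff[OF k f g])
  moreover have "(\<lambda>n. C * N (f n - g)) \<longlonglongrightarrow> 0"
    using tendsto_mult_right_zero[OF lim] .
  ultimately have "(\<lambda>n. k (f n) - k g) \<longlonglongrightarrow> 0"
    by (rule Lim_null_comparison[OF always_eventually, OF allI])
  then show ?thesis by (simp add: LIM_zero_iff)
qed

text \<open>Since \<open>S\<close> lies in \<open>X\<close>, the distance from \<open>f\<close> to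
  its points is the genuine \<open>N (f - g)\<close> and never the default value 0 of
  \<open>norm_dist\<close>.\<close>

lemma in_mtopology_closure_iff:
  assumes "S \<subseteq> X"
  shows "f \<in> Metric_space.mtopology X (norm_dist X N) closure_of S \<longleftrightarrow>
    f \<in> X \<and> (\<forall>\<epsilon>>0. \<exists>g\<in>S. N (f - g) < \<epsilon>)"
proof -
  interpret Metric_space X "norm_dist X N"
    by (rule Metric_space_norm_dist[OF X])
  have "g \<in> mball f r \<longleftrightarrow> N (f - g) < r" if "f \<in> X" "g \<in> S" for g r
    using that assms by (simp add: norm_dist_def subset_iff)
  then show ?thesis
    unfolding metric_closure_of by blast
qed

text \<open>The terms and the limit all lie in \<open>X\<close>, where \<open>norm_dist\<close> is
  \<open>N\<close> of the difference, so completeness can be used through \<open>N\<close>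
  alone.\<close>

lemma Cauchy_imp_norm_tendsto:
  assumes compl: "Metric_space.mcomplete X (norm_dist X N)"
    and f: "\<And>n. f n \<in> X"
    and Cauchy: "\<And>\<epsilon>. \<epsilon> > 0 \<Longrightarrow> \<exists>M. \<forall>m\<ge>M. \<forall>n\<ge>M. N (f m - f n) < \<epsilon>"
  obtains g where "g \<in> X" "(\<lambda>n. N (f n - g)) \<longlonglongrightarrow> 0"
proof -
  interpret Metric_space X "norm_dist X N"
    by (rule Metric_space_norm_dist[OF X])
  have "MCauchy f"
    unfolding MCauchy_def norm_dist_def image_subset_iff using f Cauchy by simp
  then obtain g where "limitin mtopology f g sequentially"
    using compl unfolding mcomplete_def by blast
  then have g: "g \<in> X" "\<forall>\<epsilon>>0. \<exists>M. \<forall>n\<ge>M. f n \<in> X \<and> norm_dist X N (f n) g < \<epsilon>"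
    unfolding limit_metric_sequentially by simp_all
  have "(\<lambda>n. N (f n - g)) \<longlonglongrightarrow> 0"
    using g(2) unfolding LIMSEQ_iff norm_dist_def by (simp add: f g(1) nfs_norm_nonneg nfs_diff)
  with g(1) show thesis by (rule that)
qed

section \<open>The closed graph theorem for functional Banach spaces\<close>

text \<open>The Baire category step of the open mapping and closed graph theorems.\<close>

lemma Baire_approximation:
  assumes compl: "Metric_space.mcomplete X (norm_dist X N)"
    and S: "\<And>f. f \<in> X \<Longrightarrow> S f \<in> X"
    and add: "\<And>f g. f \<in> X \<Longrightarrow> g \<in> X \<Longrightarrow> S (f + g) = S f + S g"
    and scale: "\<And>c f. f \<in> X \<Longrightarrow> S (\<lambda>z. c * f z) = (\<lambda>z. c * S f z)"
  obtains K where "K \<ge> 0"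
    "\<And>f \<epsilon>. f \<in> X \<Longrightarrow> \<epsilon> > 0 \<Longrightarrow> \<exists>e\<in>X. N (S e) \<le> K * N f \<and> N (f - e) < \<epsilon>"
proof -
  interpret Metric_space X "norm_dist X N"
    by (rule Metric_space_norm_dist[OF X])
  have S_diff: "S (f - g) = S f - S g" if "f \<in> X" "g \<in> X" for f g
    using add[OF nfs_diff[OF that] that(2)] by (simp add: algebra_simps)
  \<comment> \<open>The sublevel sets of \<open>N (S f)\<close> cover \<open>X\<close>, so by Baire
    the closure of one of them contains a ball.\<close>
  define E where "E n = {f \<in> X. N (S f) \<le> real n}" for n
  have E_subset: "E n \<subseteq> X" for n
    by (auto simp: E_def)
  have "X \<subseteq> (\<Union>n. mtopology closure_of E n)"
  proof
    fix f assume f: "f \<in> X"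
    obtain n where "N (S f) \<le> real n"
      using real_arch_simple by blast
    then have "f \<in> E n"
      using f by (simp add: E_def)
    then show "f \<in> (\<Union>n. mtopology closure_of E n)"
      using closure_of_subset[of "E n" mtopology] E_subset[of n] by auto
  qed
  then have "(\<Union>n. mtopology closure_of E n) = topspace mtopology"
    using closure_of_subset_topspace[of mtopology] by fastforce
  \<comment> \<open>The union is all of \<open>X\<close>, which is open and contains 0.\<close>
  then have "mtopology interior_of \<Union> (range (\<lambda>n. mtopology closure_of E n)) \<noteq> {}"
    using nfs_zero(1) by (metis empty_iff interior_of_topspace topspace_mtopology)
  moreover have "mtopology interior_of \<Union> (range (\<lambda>n. mtopology closure_of E n)) = {}"
    if "\<And>n. mtopology interior_of (mtopology closure_of E n) = {}"
    using that by (intro metric_Baire_category_alt[OF compl]) auto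
  ultimately obtain n where "mtopology interior_of (mtopology closure_of E n) \<noteq> {}"
    by blast
  then obtain a r where a: "a \<in> X" and r: "r > 0" and ball: "mball a r \<subseteq> mtopology closure_of E n"
    by (auto simp: in_interior_of_mball)
  have near: "\<exists>e\<in>E n. N (f - e) < \<epsilon>" if "f \<in> X" "N (a - f) < r" "\<epsilon> > 0" for f \<epsilon>
  proof -
    have "f \<in> mball a r"
      using that a by (simp add: norm_dist_def)
    then show ?thesis
      using ball that(3) in_mtopology_closure_iff[OF E_subset, of f n] by blast
  qed
  \<comment> \<open>The ball is moved from \<open>a\<close> to the origin: \<open>a + f\<close> and
    \<open>a - f\<close> both lie in it, and half the difference of their approximants approximates
    \<open>f\<close>. The factor 1/2 keeps both the bound \<open>real n\<close> and the error
    \<epsilon>.\<close>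
  have centred: "\<exists>e\<in>X. N (S e) \<le> real n \<and> N (f - e) < \<epsilon>"
    if f: "f \<in> X" and Nf: "N f < r" and \<epsilon>: "\<epsilon> > 0" for f \<epsilon>
  proof -
    have af: "a + f \<in> X" "a - f \<in> X"
      using a f nfs_add nfs_diff by auto
    have "N (a - (a + f)) < r" "N (a - (a - f)) < r"
      using nfs_minus[OF f] Nf by simp_all
    then obtain e1 e2 where e1: "e1 \<in> E n" "N (a + f - e1) < \<epsilon>" and e2: "e2 \<in> E n" "N (a - f - e2) < \<epsilon>"
      using near[OF af(1) _ \<epsilon>] near[OF af(2) _ \<epsilon>] by blast
    have X12: "e1 \<in> X" "e2 \<in> X" and S12: "N (S e1) \<le> real n" "N (S e2) \<le> real n"
      using e1 e2 by (auto simp: E_def)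
    define e where "e = (\<lambda>z. 1/2 * (e1 - e2) z)"
    have e: "e \<in> X"
      unfolding e_def using X12 nfs_scale nfs_diff by blast
    have "S e = (\<lambda>z. 1/2 * (S e1 - S e2) z)"
      unfolding e_def scale[OF nfs_diff[OF X12]] S_diff[OF X12] ..
    then have "N (S e) = 1/2 * N (S e1 - S e2)"
      using nfs_norm_scale[OF nfs_diff[OF S[OF X12(1)] S[OF X12(2)]], of "1/2"] by (simp del: fun_diff_def)
    then have *: "N (S e) \<le> real n"
      using nfs_norm_diff_le[OF S[OF X12(1)] S[OF X12(2)]] S12 by simp
    have d: "a + f - e1 \<in> X" "a - f - e2 \<in> X"
      using af X12 nfs_diff by auto
    have "f - e = (\<lambda>z. 1/2 * ((a + f - e1) - (a - f - e2)) z)"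
      by (simp add: e_def fun_eq_iff field_simps)
    then have "N (f - e) = 1/2 * N ((a + f - e1) - (a - f - e2))"
      using nfs_norm_scale[OF nfs_diff[OF d], of "1/2"] by simp
    then have "N (f - e) < \<epsilon>"
      using nfs_norm_diff_le[OF d] e1(2) e2(2) by simp
    with e * show ?thesis by blast
  qed
  show thesis
  proof
    show "2 * real n / r \<ge> 0"
      using r by simp
    fix f \<epsilon> assume f: "f \<in> X" and \<epsilon>: "(\<epsilon>::real) > 0"
    show "\<exists>e\<in>X. N (S e) \<le> 2 * real n / r * N f \<and> N (f - e) < \<epsilon>"
    proof (cases "f = 0")
      case True
      have "S 0 = 0"
        using S_diff[OF nfs_zero(1) nfs_zero(1)] by simp
      with True show ?thesis
        using nfs_zero \<epsilon> by (intro bexI[of _ 0]) simp_all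
    next
      case False
      then have pos: "N f > 0"
        using nfs_norm_nonneg[OF f] nfs_norm_eq_0[OF f] by simp
      \<comment> \<open>Dividing by \<open>t\<close> brings \<open>f\<close> to norm
        \<open>r / 2\<close>, strictly inside the ball of radius \<open>r\<close>. Scaling back
        multiplies the bound \<open>real n\<close> by \<open>t\<close>, which gives the constant
        \<open>2 * real n / r\<close>.\<close>
      define t where "t = 2 * N f / r"
      have t: "t > 0"
        using pos r by (simp add: t_def)
      define g where "g = (\<lambda>z. complex_of_real (1/t) * f z)"
      have g: "g \<in> X"
        unfolding g_def by (rule nfs_scale[OF f])
      have "N g = r / 2"
        unfolding g_def nfs_norm_scale[OF f] using t pos r by (simp add: norm_divide t_def)
      then obtain e where e: "e \<in> X" "N (S e) \<le> real n" "N (g - e) < \<epsilon> / t"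
        using centred[OF g, of "\<epsilon> / t"] \<epsilon> t r by auto
      have "N (S (\<lambda>z. of_real t * e z)) = t * N (S e)"
        using scale[OF e(1)] nfs_norm_scale[OF S[OF e(1)]] t by simp
      then have "N (S (\<lambda>z. of_real t * e z)) \<le> 2 * real n / r * N f"
        using mult_left_mono[OF e(2), of t] t by (simp add: t_def mult_ac)
      moreover have "f - (\<lambda>z. of_real t * e z) = (\<lambda>z. of_real t * (g - e) z)"
        using t by (simp add: fun_eq_iff g_def right_diff_distrib)
      then have "N (f - (\<lambda>z. of_real t * e z)) = t * N (g - e)"
        using nfs_norm_scale[OF nfs_diff[OF g e(1)], of "of_real t"] t by simp
      then have "N (f - (\<lambda>z. of_real t * e z)) < \<epsilon>"
        using e(3) t by (simp add: field_simps)
      ultimately show ?thesis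
        using nfs_scale[OF e(1)] by blast
    qed
  qed
qed

end

text \<open>Closed graph theorem: bounded point evaluations make the graph of \<open>S\<close> closed.\<close>

theorem closed_graph_functional_banach_space:
  assumes X: "functional_banach_space X N"
    and S: "\<And>f. f \<in> X \<Longrightarrow> S f \<in> X"
    and add: "\<And>f g. f \<in> X \<Longrightarrow> g \<in> X \<Longrightarrow> S (f + g) = S f + S g"
    and scale: "\<And>c f. f \<in> X \<Longrightarrow> S (\<lambda>z. c * f z) = (\<lambda>z. c * S f z)"
    and eval: "\<And>x. bounded_functional X N (\<lambda>f. S f x)"
  shows "bounded_operator X N S"
proof -
  have nfs: "normed_function_space X N" and compl: "Metric_space.mcomplete X (norm_dist X N)"
    and evalX: "\<And>x. bounded_functional X N (\<lambda>f. f x)"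
    using X unfolding functional_banach_space_def by auto
  note [intro, simp] = nfs_zero[OF nfs] nfs_diff[OF nfs] nfs_norm_nonneg[OF nfs] S
  have S_diff: "S (f - g) = S f - S g" if "f \<in> X" "g \<in> X" for f g
    using add[of "f - g" g] that by (simp add: algebra_simps)
  have S0: "S 0 = 0"
    using S_diff[of 0 0] by simp
  obtain K where K: "K \<ge> 0"
    and approx: "\<And>f \<epsilon>. f \<in> X \<Longrightarrow> \<epsilon> > 0 \<Longrightarrow> \<exists>e\<in>X. N (S e) \<le> K * N f \<and> N (f - e) < \<epsilon>"
    using Baire_approximation[OF nfs compl S add scale] by blast
  \<comment> \<open>The error allowed is \<open>N f / 2\<close>, so \<open>g = f - e\<close> is a
    remainder of at most half the norm, while \<open>f - g = e\<close> has a controlled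
    image.\<close>
  have "\<exists>g\<in>X. N g \<le> N f / 2 \<and> N (S (f - g)) \<le> K * N f" if f: "f \<in> X" for f
  proof (cases "f = 0")
    case True
    then show ?thesis
      using S0 nfs_zero[OF nfs] by (intro bexI[of _ 0]) (simp_all only: diff_self mult_zero_right div_0 order_refl)
  next
    case False
    then have "N f / 2 > 0"
      using nfs_norm_eq_0[OF nfs f] nfs_norm_nonneg[OF nfs f] by simp
    then obtain e where "e \<in> X" "N (S e) \<le> K * N f" "N (f - e) < N f / 2"
      using approx[OF f] by blast
    then show ?thesis
      using f by (intro bexI[of _ "f - e"]) auto
  qed
  then obtain R where R: "\<And>f. f \<in> X \<Longrightarrow> R f \<in> X" "\<And>f. f \<in> X \<Longrightarrow> N (R f) \<le> N f / 2"
    "\<And>f. f \<in> X \<Longrightarrow> N (S (f - R f)) \<le> K * N f"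
    by metis
  have "N (S f) \<le> 2 * K * N f" if f: "f \<in> X" for f
  proof -
    \<comment> \<open>Successive remainders: each step splits off an approximant
      \<open>u n - u (Suc n)\<close>, and \<open>u n\<close> tends to 0 geometrically.\<close>
    define u where "u n = (R ^^ n) f" for n
    have u0: "u 0 = f" and uSuc: "u (Suc n) = R (u n)" for n
      by (simp_all add: u_def)
    have u: "u n \<in> X" for n
      by (induction n) (simp_all add: u0 uSuc f R(1))
    have Nu: "N (u n) \<le> N f / 2 ^ n" for n
    proof (induction n)
      case (Suc n)
      then show ?case
        using R(2)[OF u[of n]] by (simp add: uSuc)
    qed (simp add: u0)
    \<comment> \<open>The increments are bounded by \<open>K * N f / 2 ^ i\<close>. Their geometric
      sum is kept as an exact difference because the induction on \<open>j\<close> then closes; the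
      subtracted term is dropped only afterwards.\<close>
    have step: "N (S (u m) - S (u (m + j))) \<le> 2 * K * N f / 2 ^ m - 2 * K * N f / 2 ^ (m + j)" for m j
    proof (induction j)
      case 0
      show ?case
        by (simp only: add_0_right diff_self nfs_zero[OF nfs] order_refl)
    next
      case (Suc j)
      have "S (u m) - S (u (m + Suc j)) = (S (u m) - S (u (m + j))) + S (u (m + j) - R (u (m + j)))"
        by (simp add: S_diff R(1) u uSuc)
      moreover have "S (u m) - S (u (m + j)) \<in> X" "S (u (m + j) - R (u (m + j))) \<in> X"
        using u R(1) by simp_all
      ultimately have "N (S (u m) - S (u (m + Suc j))) \<le> N (S (u m) - S (u (m + j))) + N (S (u (m + j) - R (u (m + j))))"
        using nfs_norm_triangle[OF nfs] by metis
      moreover have "N (S (u (m + j) - R (u (m + j)))) \<le> K * (N f / 2 ^ (m + j))"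
        using R(3)[OF u[of "m + j"]] mult_left_mono[OF Nu[of "m + j"] K] by linarith
      moreover have "2 * K * N f / 2 ^ (m + Suc j) = K * (N f / 2 ^ (m + j))"
        "2 * K * N f / 2 ^ (m + j) = 2 * (K * (N f / 2 ^ (m + j)))"
        by simp_all
      ultimately show ?case
        using Suc.IH by linarith
    qed
    have step': "N (S (u m) - S (u n)) \<le> 2 * K * N f / 2 ^ m" if "m \<le> n" for m n
    proof -
      have "0 \<le> 2 * K * N f / 2 ^ n"
        using K f by simp
      then show ?thesis
        using step[of m "n - m"] that by simp
    qed
    have "\<exists>M. \<forall>m\<ge>M. \<forall>n\<ge>M. N (S (u m) - S (u n)) < \<epsilon>" if \<epsilon>: "\<epsilon> > 0" for \<epsilon>
    proof -
      have "(\<lambda>m. 2 * K * N f / 2 ^ m) \<longlonglongrightarrow> 0"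
        by (rule LIMSEQ_divide_realpow_zero) simp
      then have "\<forall>\<^sub>F m in sequentially. 2 * K * N f / 2 ^ m < \<epsilon>"
        by (rule order_tendstoD(2)) (rule \<epsilon>)
      then obtain M where M: "\<And>m. m \<ge> M \<Longrightarrow> 2 * K * N f / 2 ^ m < \<epsilon>"
        by (auto simp: eventually_sequentially)
      have "N (S (u m) - S (u n)) < \<epsilon>" if "m \<ge> M" "n \<ge> M" for m n
      proof (cases "m \<le> n")
        case True
        then show ?thesis
          using step'[of m n] M[OF that(1)] by simp
      next
        case False
        then show ?thesis
          using step'[of n m] M[OF that(2)] nfs_norm_commute[OF nfs S S, of "u m" "u n"] u by simp
      qed
      then show ?thesis by blast
    qed
    then obtain h where h: "h \<in> X" "(\<lambda>n. N (S (u n) - h)) \<longlonglongrightarrow> 0"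
      by (rule Cauchy_imp_norm_tendsto[OF nfs compl S[OF u]])
    have "(\<lambda>n. N (u n - 0)) \<longlonglongrightarrow> 0"
    proof (rule tendsto_sandwich)
      show "\<forall>\<^sub>F n in sequentially. 0 \<le> N (u n - 0)"
        using u by simp
      show "\<forall>\<^sub>F n in sequentially. N (u n - 0) \<le> N f / 2 ^ n"
        using Nu by simp
      show "(\<lambda>n. N f / 2 ^ n) \<longlonglongrightarrow> 0"
        by (rule LIMSEQ_divide_realpow_zero) simp
    qed simp
    \<comment> \<open>Closedness of the graph: the values \<open>S (u n) x\<close> are followed once
      through the bounded functional \<open>f \<mapsto> S f x\<close> along \<open>u n\<close>, and
      once through evaluation at \<open>x\<close> along \<open>S (u n)\<close>. Hence the norm limit
      \<open>h\<close> must be \<open>S 0\<close>.\<close>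
    then have "(\<lambda>n. S (u n) x) \<longlonglongrightarrow> S 0 x" for x
      using bounded_functional_tendsto[OF nfs eval u nfs_zero(1)[OF nfs]] by simp
    moreover have "(\<lambda>n. S (u n) x) \<longlonglongrightarrow> h x" for x
      using bounded_functional_tendsto[OF nfs evalX S[OF u] h] by simp
    ultimately have "h = S 0"
      using LIMSEQ_unique by blast
    then have "h = 0"
      using S0 by simp
    then have lim: "(\<lambda>n. 2 * K * N f + N (S (u n))) \<longlonglongrightarrow> 2 * K * N f + 0"
      using h(2) by (intro tendsto_intros) simp
    have "N (S f) \<le> 2 * K * N f + N (S (u n))" for n
      using nfs_norm_triangle[OF nfs, of "S f - S (u n)" "S (u n)"] step'[of 0 n] u f by (simp add: u0)
    then show ?thesis
      using LIMSEQ_le_const[OF lim] by auto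
  qed
  then show ?thesis
    unfolding bounded_operator_def
    by (intro conjI ballI allI exI[of _ "2 * K"]) (rule S add scale, assumption+ | assumption)+
qed

section \<open>Removable singularities of a bounded quotient\<close>

text \<open>The point \<beta> shows that \<open>H\<close> is not identically zero on the connected
  set \<open>S\<close>, so its zeros are isolated. Near each of them the quotient is bounded, hence
  the singularity is removable by Riemann's theorem, and the bound \<open>B\<close> survives in the
  limit.\<close>

lemma bounded_holomorphic_quotient_extends:
  fixes G H :: "complex \<Rightarrow> complex"
  assumes G: "G holomorphic_on S" and H: "H holomorphic_on S" and S: "open S" "connected S"
    and \<beta>: "\<beta> \<in> S" "H \<beta> \<noteq> 0"
    and bound: "\<And>z. z \<in> S \<Longrightarrow> H z \<noteq> 0 \<Longrightarrow> cmod (G z / H z) \<le> B"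
  obtains \<Phi> where "\<Phi> holomorphic_on S" "\<And>z. z \<in> S \<Longrightarrow> H z \<noteq> 0 \<Longrightarrow> \<Phi> z = G z / H z"
    "\<And>z. z \<in> S \<Longrightarrow> cmod (\<Phi> z) \<le> B"
proof -
  define Q where "Q z = G z / H z" for z
  have *: "remove_sings Q analytic_on {z} \<and> cmod (remove_sings Q z) \<le> B" if z: "z \<in> S" for z
  proof -
    have ev: "\<forall>\<^sub>F w in at z. H w \<noteq> 0 \<and> w \<in> S"
      using non_zero_neighbour_alt[OF H S z \<beta>] .
    then obtain r where r: "r > 0" and "\<forall>w. w \<noteq> z \<and> dist w z < r \<longrightarrow> H w \<noteq> 0 \<and> w \<in> S"
      unfolding eventually_at by auto
    then have ball: "ball z r - {z} \<subseteq> {w \<in> S. H w \<noteq> 0}"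
      by (auto simp: dist_commute)
    have holQ: "Q holomorphic_on ball z r - {z}"
      unfolding Q_def using ball
      by (intro holomorphic_on_divide holomorphic_on_subset[OF G] holomorphic_on_subset[OF H]) auto
    have evB: "\<forall>\<^sub>F w in at z. cmod (Q w) \<le> B"
      using ev by eventually_elim (auto simp: Q_def intro!: bound)
    \<comment> \<open>The local extension \<open>g\<close> serves to produce the limit of
      \<open>Q\<close> at \<open>z\<close>. The function \<open>remove_sings Q\<close> takes exactly
      these limits, so no gluing of local extensions is needed.\<close>
    then obtain g where g: "g holomorphic_on ball z r" "\<And>w. w \<in> ball z r - {z} \<Longrightarrow> g w = Q w"
      using holomorphic_on_extend_bounded[OF holQ] r by auto
    have "isCont g z"
      using continuous_on_interior[OF holomorphic_on_imp_continuous_on[OF g(1)], of z] r by simp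
    moreover have "\<forall>\<^sub>F w in at z. g w = Q w"
      using g(2) r unfolding eventually_at by (auto simp: dist_commute intro!: exI[of _ r])
    ultimately have lim: "Q \<midarrow>z\<rightarrow> g z"
      unfolding isCont_def using tendsto_cong by fast
    have "isolated_singularity_at Q z"
      by (rule isolated_singularity_at_holomorphic[OF holQ]) (use r in auto)
    then have "remove_sings Q analytic_on {z}"
      using lim by (rule remove_sings_analytic_at)
    moreover have "cmod (g z) \<le> B"
      using tendsto_upperbound[OF tendsto_norm[OF lim] evB] by simp
    ultimately show ?thesis
      using remove_sings_eqI[OF lim] by simp
  qed
  show thesis
  proof
    show "remove_sings Q holomorphic_on S"
      using * analytic_on_analytic_at analytic_imp_holomorphic by blast
    show "cmod (remove_sings Q z) \<le> B" if "z \<in> S" for z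
      using * that by blast
    show "remove_sings Q z = G z / H z" if z: "z \<in> S" "H z \<noteq> 0" for z
    proof -
      have "G analytic_on {z}" "H analytic_on {z}"
        using G H S z by (auto simp: analytic_at)
      then have "Q analytic_on {z}"
        unfolding Q_def using z by (intro analytic_on_divide) auto
      then show ?thesis
        by (simp add: Q_def)
    qed
  qed
qed

section \<open>Algebraic consistency of \<open>\<psi> *o A\<close>\<close>

lemma of_disc_less_1 [simp]: "cmod (of_disc z) < 1"
  using of_disc[of z] by simp

lemma poly_fun_const: "poly_fun [:c:] = (\<lambda>z. c)"
  by (simp add: poly_fun_def)

text \<open>
  A nonzero almost multiplicative functional \<open>k\<close> on \<open>\<psi>A\<close> induces \<open>f \<mapsto> k (\<psi>f) / k \<psi>\<close> on \<open>A\<close>.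
  Density of the polynomials only serves to show \<open>k \<psi> \<noteq> 0\<close>.
\<close>

lemma algebraically_consistent_multiple:
  fixes A :: "(disc \<Rightarrow> complex) set"
  assumes A: "functional_banach_space A N"
    and cons: "algebraically_consistent A N"
    and dense: "polynomials_dense A N"
    and polys: "\<And>p. poly_fun p *o A \<subseteq> A"
    and \<psi>: "\<psi> *o A \<subseteq> A"
  shows "algebraically_consistent (\<psi> *o A) N"
proof -
  have nfs: "normed_function_space A N" and evalA: "\<And>x. bounded_functional A N (\<lambda>f. f x)"
    using A unfolding functional_banach_space_def by auto
  have polyA: "poly_fun p \<in> A" for p
    using dense unfolding polynomials_dense_def by auto
  have one: "1 \<in> A"
    using polyA[of "[:1:]"] by (simp add: poly_fun_const one_fun_def)
  have poly_mult: "poly_fun p * f \<in> A" if "f \<in> A" for p f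
    using polys[of p] that by (auto simp: elt_set_times_def)
  have mult: "\<psi> * f \<in> A" if "f \<in> A" for f
    using \<psi> that by (auto simp: elt_set_times_def)
  have multI: "\<psi> * f \<in> \<psi> *o A" if "f \<in> A" for f
    using that by (auto simp: elt_set_times_def)
  have distrib: "\<psi> * (f + g) = \<psi> * f + \<psi> * g" for f g
    by (rule distrib_left)
  have scale: "\<psi> * (\<lambda>z. c * f z) = (\<lambda>z. c * (\<psi> * f) z)" for c f
    by (simp add: fun_eq_iff)
  \<comment> \<open>Boundedness of multiplication by \<psi> makes
    \<open>f \<mapsto> k (\<psi> * f)\<close> a bounded functional on \<open>A\<close> whenever
    \<open>k\<close> is one on \<open>\<psi> *o A\<close>.\<close>
  have "bounded_operator A N ((*) \<psi>)"
  proof (rule closed_graph_functional_banach_space[OF A mult distrib scale])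
    fix x
    obtain C where C: "\<And>f. f \<in> A \<Longrightarrow> cmod (f x) \<le> C * N f"
      using evalA unfolding bounded_functional_def by blast
    have "cmod ((\<psi> * f) x) \<le> (cmod (\<psi> x) * C) * N f" if "f \<in> A" for f
      using mult_left_mono[OF C[OF that], of "cmod (\<psi> x)"] by (simp add: norm_mult mult_ac)
    then show "bounded_functional A N (\<lambda>f. (\<psi> * f) x)"
      unfolding bounded_functional_def by (auto simp: distrib_left)
  qed
  then obtain C where C: "\<And>f. f \<in> A \<Longrightarrow> N (\<psi> * f) \<le> C * N f"
    unfolding bounded_operator_def by blast
  have "\<exists>x. \<forall>f\<in>\<psi> *o A. k f = f x"
    if k: "bounded_functional (\<psi> *o A) N k" and am: "almost_multiplicative (\<psi> *o A) k"
      and nz: "\<exists>f\<in>\<psi> *o A. k f \<noteq> 0" for k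
  proof -
    obtain D where D: "\<And>f. f \<in> \<psi> *o A \<Longrightarrow> cmod (k f) \<le> D * N f"
      using k unfolding bounded_functional_def by blast
    have "cmod (k (\<psi> * f)) \<le> (\<bar>D\<bar> * C) * N f" if f: "f \<in> A" for f
    proof -
      have "cmod (k (\<psi> * f)) \<le> D * N (\<psi> * f)"
        by (rule D[OF multI[OF f]])
      also have "\<dots> \<le> \<bar>D\<bar> * N (\<psi> * f)"
        using nfs_norm_nonneg[OF nfs mult[OF f]] by (intro mult_right_mono) auto
      also have "\<dots> \<le> \<bar>D\<bar> * (C * N f)"
        using C[OF f] by (intro mult_left_mono) auto
      finally show ?thesis by (simp add: mult_ac)
    qed
    then have km: "bounded_functional A N (\<lambda>f. k (\<psi> * f))"
      using k multI unfolding bounded_functional_def distrib scale by blast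
    have k_mult: "k (\<psi> * f) * k (\<psi> * g) = k (\<psi> * (\<psi> * (f * g)))"
      if "f \<in> A" "g \<in> A" "f * g \<in> A" for f g
    proof -
      have eq: "(\<psi> * f) * (\<psi> * g) = \<psi> * (\<psi> * (f * g))"
        by (simp add: mult_ac)
      show ?thesis
        using am multI[OF that(1)] multI[OF that(2)] multI[OF mult[OF that(3)]] eq
        unfolding almost_multiplicative_def by metis
    qed
    \<comment> \<open>The pairs \<open>f, g\<close> and \<open>1, f * g\<close> lead to the same
      product \<open>\<psi> * (\<psi> * (f * g))\<close>, so \<open>k_mult\<close> for both pairs
      can be compared.\<close>
    have k_\<psi>: "k (\<psi> * f) * k (\<psi> * g) = k \<psi> * k (\<psi> * (f * g))"
      if "f \<in> A" "g \<in> A" "f * g \<in> A" for f g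
      using k_mult[OF that] k_mult[OF one that(3)] that(3) by simp
    have "k \<psi> \<noteq> 0"
    proof
      assume k0: "k \<psi> = 0"
      \<comment> \<open>Taking both factors equal to \<open>poly_fun p\<close> makes the square of
        \<open>k (\<psi> * poly_fun p)\<close> vanish. Polynomials are used because their squares
        stay in \<open>A\<close>; density then carries the vanishing over to all of
        \<open>A\<close>.\<close>
      have k_poly: "k (\<psi> * poly_fun p) = 0" for p
        using k_\<psi>[OF polyA[of p] polyA[of p] poly_mult[OF polyA]] k0 by simp
      have "k (\<psi> * f) = 0" if f: "f \<in> A" for f
      proof -
        have "\<exists>p. N (poly_fun p - f) < inverse (Suc n)" for n
        proof -
          have "f \<in> Metric_space.mtopology A (norm_dist A N) closure_of range poly_fun"
            using dense f unfolding polynomials_dense_def by blast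
          then obtain p where "N (f - poly_fun p) < inverse (Suc n)"
            using in_mtopology_closure_iff[OF nfs, of "range poly_fun" f] polyA
            by (metis (no_types, lifting) image_iff image_subset_iff inverse_positive_iff_positive
                of_nat_0_less_iff zero_less_Suc)
          then show ?thesis
            using nfs_norm_commute[OF nfs f polyA] by metis
        qed
        then obtain p where p: "\<And>n. N (poly_fun (p n) - f) < inverse (Suc n)"
          by metis
        have "(\<lambda>n. N (poly_fun (p n) - f)) \<longlonglongrightarrow> 0"
          by (rule tendsto_sandwich[OF _ _ tendsto_const LIMSEQ_inverse_real_of_nat])
            (use p nfs_norm_nonneg[OF nfs nfs_diff[OF nfs polyA f]] in \<open>auto intro!: always_eventually less_imp_le\<close>)
        then have "(\<lambda>n. k (\<psi> * poly_fun (p n))) \<longlonglongrightarrow> k (\<psi> * f)"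
          by (rule bounded_functional_tendsto[OF nfs km polyA f])
        then show ?thesis
          unfolding k_poly by (rule LIMSEQ_unique[OF _ tendsto_const])
      qed
      then show False
        using nz by (auto simp: elt_set_times_def)
    qed
    define l where "l f = k (\<psi> * f) / k \<psi>" for f
    have "bounded_functional A N l"
    proof -
      obtain C' where C': "\<And>f. f \<in> A \<Longrightarrow> cmod (k (\<psi> * f)) \<le> C' * N f"
        using km unfolding bounded_functional_def by blast
      have "cmod (l f) \<le> (C' / cmod (k \<psi>)) * N f" if "f \<in> A" for f
        using divide_right_mono[OF C'[OF that], of "cmod (k \<psi>)"] by (simp add: l_def norm_divide)
      moreover have "l (f + g) = l f + l g" if "f \<in> A" "g \<in> A" for f g
        using km that unfolding bounded_functional_def l_def by (simp add: add_divide_distrib)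
      moreover have "l (\<lambda>z. c * f z) = c * l f" if "f \<in> A" for c f
        using km that unfolding bounded_functional_def l_def by simp
      ultimately show ?thesis
        unfolding bounded_functional_def by blast
    qed
    moreover have "almost_multiplicative A l"
      unfolding almost_multiplicative_def l_def using k_\<psi> \<open>k \<psi> \<noteq> 0\<close> by (auto simp: field_simps)
    moreover have "l 1 \<noteq> 0"
      using \<open>k \<psi> \<noteq> 0\<close> by (simp add: l_def)
    ultimately obtain x where x: "\<And>f. f \<in> A \<Longrightarrow> l f = f x"
      using cons one unfolding algebraically_consistent_def by blast
    have k_eq: "k (\<psi> * f) = k \<psi> * f x" if "f \<in> A" for f
      using x[OF that] \<open>k \<psi> \<noteq> 0\<close> by (simp add: l_def field_simps)
    have "\<psi> \<in> A"
      using mult[OF one] by simp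
    \<comment> \<open>\<open>k_mult\<close> at \<open>1, 1\<close> says that the square of
      \<open>k \<psi>\<close> is \<open>k (\<psi> * \<psi>)\<close>, while \<open>k_eq\<close> at
      \<psi> gives \<open>k \<psi> * \<psi> x\<close> for it; cancel
      \<open>k \<psi>\<close>.\<close>
    then have "k \<psi> = \<psi> x"
      using k_eq[of \<psi>] k_mult[OF one one] one \<open>k \<psi> \<noteq> 0\<close> by simp
    then show ?thesis
      using k_eq by (auto simp: elt_set_times_def)
  qed
  moreover have "bounded_functional (\<psi> *o A) N (\<lambda>f. f x)" for x
    using evalA[of x] \<psi> unfolding bounded_functional_def by blast
  ultimately show ?thesis
    unfolding algebraically_consistent_def by blast
qed

section \<open>Almost multiplicative operators on \<open>\<psi> *o A\<close> as composition
  operators\<close>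

theorem corollary6p8:
  fixes A :: "(disc \<Rightarrow> complex) set"
    and N :: "(disc \<Rightarrow> complex) \<Rightarrow> real"
    and \<psi> :: "disc \<Rightarrow> complex"
    and T :: "(disc \<Rightarrow> complex) \<Rightarrow> (disc \<Rightarrow> complex)"
  assumes "functional_banach_space A N"
    and "\<forall>f\<in>A. analytic_fun f"
    and "algebraically_consistent A N"
    and "polynomials_dense A N"
    and "\<forall>p. poly_fun p *o A \<subseteq> A"
    and "analytic_fun \<psi>"
    and "\<psi> *o A \<subseteq> A"
    and "bounded_operator (\<psi> *o A) N T"
    and "\<exists>f \<in> \<psi> *o A. T f \<noteq> 0"
  shows "almost_multiplicative (\<psi> *o A) T \<longleftrightarrow> composition_operator (\<psi> *o A) T"
proof
  assume "composition_operator (\<psi> *o A) T"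
  then show "almost_multiplicative (\<psi> *o A) T"
    by (auto simp: composition_operator_def almost_multiplicative_def fun_eq_iff)
next
  assume am: "almost_multiplicative (\<psi> *o A) T"
  have evalA: "\<And>x. bounded_functional A N (\<lambda>f. f x)" and nfs: "normed_function_space A N"
    using assms(1) unfolding functional_banach_space_def by auto
  have polyA: "poly_fun p \<in> A" for p
    using assms(4) unfolding polynomials_dense_def by auto
  have multI: "\<psi> * f \<in> \<psi> *o A" if "f \<in> A" for f
    using that by (auto simp: elt_set_times_def)
  have TX: "T f \<in> \<psi> *o A" if "f \<in> \<psi> *o A" for f
    using assms(8) that unfolding bounded_operator_def by blast
  have cons: "algebraically_consistent (\<psi> *o A) N"
    using algebraically_consistent_multiple assms(1,3,4,5,7) by blast
  have "1 \<in> A"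
    using polyA[of "[:1:]"] by (simp add: poly_fun_const one_fun_def)
  then have \<psi>X: "\<psi> \<in> \<psi> *o A"
    using multI[of 1] by simp
  \<comment> \<open>At a point \<open>x\<close> with \<open>\<psi> x \<noteq> 0\<close>, the
    quotient of \<zeta> by \<psi> is \<open>x\<close> itself, so the values of
    \<open>T \<zeta>\<close> and \<open>T \<psi>\<close> reveal the evaluation point.\<close>
  define \<zeta> where "\<zeta> = \<psi> * poly_fun [:0, 1:]"
  have \<zeta>X: "\<zeta> \<in> \<psi> *o A"
    unfolding \<zeta>_def by (rule multI[OF polyA])
  \<comment> \<open>Algebraic consistency is applied to \<open>f \<mapsto> T f w\<close>. In the
    second alternative \<open>\<psi> x = 0\<close> is impossible, since every element of
    \<open>\<psi> *o A\<close> would then vanish at \<open>x\<close>.\<close>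
  have point: "(\<forall>f\<in>\<psi> *o A. T f w = 0) \<or> (\<exists>x. \<psi> x \<noteq> 0 \<and> (\<forall>f\<in>\<psi> *o A. T f w = f x))" for w
  proof (cases "\<forall>f\<in>\<psi> *o A. T f w = 0")
    case False
    have "bounded_functional (\<psi> *o A) N (\<lambda>f. T f w)"
    proof -
      obtain C where C: "\<And>f. f \<in> A \<Longrightarrow> cmod (f w) \<le> C * N f"
        using evalA unfolding bounded_functional_def by blast
      obtain D where D: "\<And>f. f \<in> \<psi> *o A \<Longrightarrow> N (T f) \<le> D * N f"
        using assms(8) unfolding bounded_operator_def by blast
      have "cmod (T f w) \<le> (\<bar>C\<bar> * D) * N f" if f: "f \<in> \<psi> *o A" for f
      proof -
        have Tf: "T f \<in> A"
          using TX[OF f] assms(7) by blast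
        have "cmod (T f w) \<le> C * N (T f)"
          by (rule C[OF Tf])
        also have "\<dots> \<le> \<bar>C\<bar> * N (T f)"
          using nfs_norm_nonneg[OF nfs Tf] by (intro mult_right_mono) auto
        also have "\<dots> \<le> \<bar>C\<bar> * (D * N f)"
          using D[OF f] by (intro mult_left_mono) auto
        finally show ?thesis by (simp add: mult_ac)
      qed
      then show ?thesis
        using assms(8) unfolding bounded_functional_def bounded_operator_def by auto
    qed
    moreover have "almost_multiplicative (\<psi> *o A) (\<lambda>f. T f w)"
      using am unfolding almost_multiplicative_def by simp
    ultimately obtain x where x: "\<forall>f\<in>\<psi> *o A. T f w = f x"
      using cons False unfolding algebraically_consistent_def by blast
    then have "\<psi> x \<noteq> 0"
      using False by (auto simp: elt_set_times_def)
    with x show ?thesis by blast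
  qed simp
  have "analytic_fun (T \<psi>)" "analytic_fun (T \<zeta>)"
    using TX[OF \<psi>X] TX[OF \<zeta>X] assms(2,7) by blast+
  then obtain H G where H: "H holomorphic_on ball 0 1" "\<And>w. T \<psi> w = H (of_disc w)"
    and G: "G holomorphic_on ball 0 1" "\<And>w. T \<zeta> w = G (of_disc w)"
    unfolding analytic_fun_def using analytic_imp_holomorphic by blast
  obtain \<Psi> where \<Psi>: "\<Psi> holomorphic_on ball 0 1" "\<And>w. \<psi> w = \<Psi> (of_disc w)"
    using assms(6) unfolding analytic_fun_def using analytic_imp_holomorphic by blast
  have quot: "\<exists>x. of_disc x = G (of_disc w) / H (of_disc w) \<and> (\<forall>f\<in>\<psi> *o A. T f w = f x)"
    if nz: "H (of_disc w) \<noteq> 0" for w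
  proof -
    obtain x where x: "\<forall>f\<in>\<psi> *o A. T f w = f x" "\<psi> x \<noteq> 0"
      using point[of w] \<psi>X nz unfolding H(2)[symmetric] by blast
    then have "G (of_disc w) = H (of_disc w) * of_disc x"
      using \<psi>X \<zeta>X H(2)[of w] G(2)[of w] by (simp add: \<zeta>_def poly_fun_def)
    then show ?thesis
      using x(1) nz by (intro exI[of _ x]) (simp add: field_simps)
  qed
  \<comment> \<open>Some \<open>T f\<close> is nonzero at some point; there the second alternative
    of \<open>point\<close> holds, and \<open>T \<psi>\<close> takes a nonzero value
    \<open>\<psi> x\<close>.\<close>
  obtain w0 where w0: "H (of_disc w0) \<noteq> 0"
    using assms(9) point \<psi>X H(2) by (metis ext zero_fun_apply)
  have ball: "\<exists>w. z = of_disc w" if "z \<in> ball 0 1" for z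
    using Disc_inverse[OF that] by metis
  have quot_less: "cmod (G z / H z) < 1" if "z \<in> ball 0 1" "H z \<noteq> 0" for z
    using ball[OF that(1)] quot that(2) of_disc_less_1 by metis
  obtain \<Phi> where \<Phi>: "\<Phi> holomorphic_on ball 0 1"
    "\<And>z. z \<in> ball 0 1 \<Longrightarrow> H z \<noteq> 0 \<Longrightarrow> \<Phi> z = G z / H z"
    "\<And>z. z \<in> ball 0 1 \<Longrightarrow> cmod (\<Phi> z) \<le> 1"
    using bounded_holomorphic_quotient_extends[OF G(1) H(1) open_ball connected_ball of_disc w0, of 1]
      quot_less less_imp_le by metis
  \<comment> \<open>The extension inherits only the weak bound 1. Modulus 1 at an interior point
    would be a maximum and make \<Phi> constant, contrary to the strict bound at
    \<open>w0\<close>.\<close>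
  have \<Phi>_less: "cmod (\<Phi> z) < 1" if z: "z \<in> ball 0 1" for z
  proof (rule ccontr)
    assume "\<not> cmod (\<Phi> z) < 1"
    then have "cmod (\<Phi> z') \<le> cmod (\<Phi> z)" if "z' \<in> ball 0 1" for z'
      using \<Phi>(3)[OF that] by simp
    then have "\<Phi> constant_on ball 0 1"
      using maximum_modulus_principle[OF \<Phi>(1) open_ball connected_ball open_ball order_refl z] by blast
    then have "\<Phi> z = \<Phi> (of_disc w0)"
      using z of_disc[of w0] unfolding constant_on_def by metis
    then show False
      using \<open>\<not> cmod (\<Phi> z) < 1\<close> \<Phi>(2)[OF of_disc w0] quot_less[OF of_disc w0] by simp
  qed
  define \<phi> where "\<phi> w = Disc (\<Phi> (of_disc w))" for w
  have \<phi>: "of_disc (\<phi> w) = \<Phi> (of_disc w)" for w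
    unfolding \<phi>_def using \<Phi>_less[OF of_disc[of w]] by (intro Disc_inverse) simp
  have T_eq: "T f w = f (\<phi> w)" if "H (of_disc w) \<noteq> 0" "f \<in> \<psi> *o A" for f w
    using quot[OF that(1)] that \<Phi>(2)[OF of_disc that(1)] \<phi>[of w] by (metis of_disc_inverse)
  \<comment> \<open>Both sides are continuous at \<open>z\<close> and agree on a punctured
    neighbourhood, where \<open>H\<close> has no zeros.\<close>
  have H_eq: "H z = \<Psi> (\<Phi> z)" if z: "z \<in> ball 0 1" for z
  proof -
    have "\<forall>\<^sub>F w in at z. H w \<noteq> 0 \<and> w \<in> ball 0 1"
      using non_zero_neighbour_alt[OF H(1) open_ball connected_ball z of_disc w0] .
    then have ev: "\<forall>\<^sub>F w in at z. \<Psi> (\<Phi> w) = H w"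
      by eventually_elim (use ball T_eq[OF _ \<psi>X] H(2) \<Psi>(2) \<phi> in metis)
    have "\<Psi> \<circ> \<Phi> holomorphic_on ball 0 1"
      using \<Phi>_less by (intro holomorphic_on_compose_gen[OF \<Phi>(1) \<Psi>(1)]) auto
    then have "isCont (\<Psi> \<circ> \<Phi>) z" "isCont H z"
      using H(1) z holomorphic_on_imp_continuous_on continuous_on_eq_continuous_at[OF open_ball] by blast+
    then have "((\<lambda>w. \<Psi> (\<Phi> w)) \<longlongrightarrow> \<Psi> (\<Phi> z)) (at z)" "(H \<longlongrightarrow> H z) (at z)"
      by (simp_all add: isCont_def o_def)
    then show ?thesis
      using tendsto_cong[OF ev] tendsto_unique[OF at_neq_bot] by blast
  qed
  have "T f w = f (\<phi> w)" if f: "f \<in> \<psi> *o A" for f w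
  \<comment> \<open>At a zero of \<open>T \<psi>\<close> the first alternative of
    \<open>point\<close> must hold, so \<open>T f w = 0\<close>. By \<open>H_eq\<close>, \<psi>
    vanishes at \<open>\<phi> w\<close>, and with it every element of
    \<open>\<psi> *o A\<close>.\<close>
  proof (cases "H (of_disc w) = 0")
    case True
    then have "T f w = 0"
      using point[of w] f \<psi>X H(2)[of w] by auto
    moreover have "\<psi> (\<phi> w) = 0"
      using H_eq[OF of_disc[of w]] True by (simp add: \<Psi>(2) \<phi>)
    ultimately show ?thesis
      using f by (auto simp: elt_set_times_def)
  qed (use T_eq f in auto)
  moreover have "analytic_self_map \<phi>"
    unfolding analytic_self_map_def analytic_fun_def
    using \<Phi>(1) \<phi> by (intro exI[of _ \<Phi>]) (simp add: analytic_on_open)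
  ultimately show "composition_operator (\<psi> *o A) T"
    unfolding composition_operator_def by (auto simp: fun_eq_iff)
qed

end
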